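(* For $k\geq 3$, let $S_k^2$ be the spider with $k$ legs, each of length $2$. Then \[\mathrm{max}\text{-}\overline{\mathrm{cr}}(S_k^2)=\binom{2k}{2}-2\binom{k}{2}-k+\left\lfloor\frac{k^2}{4}\right\rfloor.\]
   Context: A spider is a subdivision of the star $K_{1,k}$; each path from the degree-$k$ center vertex to a leaf is a leg, and the length of a leg is its number of edges. So $S_k^2$ is obtained from $K_{1,k}$ by subdividing every edge exactly once. A good drawing of a graph in the plane is one in which no edge crosses itself, any two edges share at most one point (counting endpoints), no three edges share a common interior crossing point, and edges do not contain vertices in their interior. A rectilinear drawing is a good drawing in which every edge is a straight line segment. The maximum rectilinear crossing number $\mathrm{max}\text{-}\overline{\mathrm{cr}}(G)$ is the maximum number of crossings over all rectilinear drawings of $G$. *)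

theory Defs
  imports "HOL-Analysis.Analysis"
begin

text \<open>A graph is a pair of a vertex set and a set of two-element edge sets.\<close>

type_synonym 'a graph = "'a set \<times> 'a set set"

type_synonym plane = "real \<times> real"

definition verts :: "'a graph \<Rightarrow> 'a set" where
  "verts G = fst G"

definition edges :: "'a graph \<Rightarrow> 'a set set" where
  "edges G = snd G"

text \<open>A spider with \<open>k\<close> legs, all of length \<open>l\<close>: \<open>leg_vertex i j\<close> is the vertex at distance
  \<open>j\<close> from the center on leg \<open>i\<close>, so that all legs share the vertex at distance 0.\<close>

datatype spider_vertex = Center | Leg nat nat

definition leg_vertex :: "nat \<Rightarrow> nat \<Rightarrow> spider_vertex" where
  "leg_vertex i j = (if j = 0 then Center else Leg i j)"

definition spider :: "nat \<Rightarrow> nat \<Rightarrow> spider_vertex graph" where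
  "spider k l =
    (insert Center {leg_vertex i j | i j. i < k \<and> j \<le> l},
     {{leg_vertex i j, leg_vertex i (Suc j)} | i j. i < k \<and> j < l})"

text \<open>A drawing consists of a placement \<open>pos\<close> of the vertices and, for every edge, the point set
  \<open>im e\<close> of the curve representing it.\<close>

definition edge_interior :: "('a \<Rightarrow> plane) \<Rightarrow> ('a set \<Rightarrow> plane set) \<Rightarrow> 'a set \<Rightarrow> plane set" where
  "edge_interior pos im e = im e - pos ` e"

text \<open>That no edge crosses itself is expressed by the injectivity contained in \<^const>\<open>arc\<close>.\<close>

definition good_drawing :: "'a graph \<Rightarrow> ('a \<Rightarrow> plane) \<Rightarrow> ('a set \<Rightarrow> plane set) \<Rightarrow> bool" where
  "good_drawing G pos im \<longleftrightarrow>
     inj_on pos (verts G) \<and>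
     (\<forall>e\<in>edges G. \<exists>g. arc g \<and> path_image g = im e \<and> {pathstart g, pathfinish g} = pos ` e) \<and>
     (\<forall>e\<in>edges G. \<forall>f\<in>edges G. e \<noteq> f \<longrightarrow> (\<exists>p. im e \<inter> im f \<subseteq> {p})) \<and>
     (\<forall>e\<in>edges G. \<forall>f\<in>edges G. \<forall>h\<in>edges G. e \<noteq> f \<and> e \<noteq> h \<and> f \<noteq> h \<longrightarrow>
        edge_interior pos im e \<inter> edge_interior pos im f \<inter> edge_interior pos im h = {}) \<and>
     (\<forall>e\<in>edges G. \<forall>v\<in>verts G. pos v \<notin> edge_interior pos im e)"

text \<open>For \<open>e = {u, v}\<close> this is \<open>closed_segment (pos u) (pos v)\<close>, see \<open>segment_convex_hull\<close>.\<close>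

definition straight_edge :: "('a \<Rightarrow> plane) \<Rightarrow> 'a set \<Rightarrow> plane set" where
  "straight_edge pos e = convex hull (pos ` e)"

definition rectilinear_drawing :: "'a graph \<Rightarrow> ('a \<Rightarrow> plane) \<Rightarrow> bool" where
  "rectilinear_drawing G pos \<longleftrightarrow> good_drawing G pos (straight_edge pos)"

text \<open>In a good drawing two edges cross at most once and no point lies on three edge interiors, so
  crossings correspond to unordered pairs of edges with intersecting interiors.\<close>

definition crossings :: "'a graph \<Rightarrow> ('a \<Rightarrow> plane) \<Rightarrow> nat" where
  "crossings G pos =
     card {{e, f} | e f. e \<in> edges G \<and> f \<in> edges G \<and> e \<noteq> f \<and>
       edge_interior pos (straight_edge pos) e \<inter> edge_interior pos (straight_edge pos) f \<noteq> {}}"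

definition max_rectilinear_crossing_number :: "'a graph \<Rightarrow> nat" where
  "max_rectilinear_crossing_number G = Max {crossings G pos | pos. rectilinear_drawing G pos}"

end

theory Submission
  imports Defs
begin

text \<open>
  Call the edges at the center inner and the other ones outer. Crossings only occur between two outer
  edges, or between an inner and an outer edge of different legs. So two legs contribute at most three
  crossings, and they contribute three only if each inner edge crosses the outer edge of the other
  leg. In that case each leg turns towards the other, so the two legs turn in opposite directions.
  Hence at most $\lfloor k^2/4 \rfloor$ pairs contribute three, and the other pairs at most two.

  For the lower bound, let the outer edges be long pieces of tangents to a parabola, seen from a
  center at vertical infinity; about half of the legs start to the right of all intersection points
  of the tangents and run to the left, the others start on the left and run to the right. A
  projective map then brings the center into the plane.
\<close>

section \<open>Edges and crossings of the spider with legs of length 2\<close>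

definition inner_edge :: "nat \<Rightarrow> spider_vertex set" where
  "inner_edge i = {Center, Leg i 1}"

definition outer_edge :: "nat \<Rightarrow> spider_vertex set" where
  "outer_edge i = {Leg i 1, Leg i 2}"

lemma edges_spider2: "edges (spider k 2) = inner_edge ` {..<k} \<union> outer_edge ` {..<k}"
proof -
  have "edges (spider k 2) = {{leg_vertex i j, leg_vertex i (Suc j)} | i j. i < k \<and> (j = 0 \<or> j = 1)}"
    unfolding edges_def spider_def by (auto simp: less_2_cases_iff)
  also have "\<dots> = inner_edge ` {..<k} \<union> outer_edge ` {..<k}"
    unfolding inner_edge_def outer_edge_def leg_vertex_def by (auto simp: numeral_2_eq_2)
  finally show ?thesis .
qed

lemma verts_spider2:
  "verts (spider k 2) = insert Center ((\<lambda>i. Leg i 1) ` {..<k} \<union> (\<lambda>i. Leg i 2) ` {..<k})"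
proof -
  have le2: "j \<le> 2 \<longleftrightarrow> j = 0 \<or> j = 1 \<or> j = 2" for j :: nat by auto
  have "{leg_vertex i j | i j. i < k \<and> j \<le> 2} =
      (\<Union>i<k. {leg_vertex i 0, leg_vertex i 1, leg_vertex i 2})"
    unfolding le2 by blast
  then show ?thesis
    unfolding verts_def spider_def by (auto simp: leg_vertex_def)
qed

lemma inner_edge_eq_iff [simp]: "inner_edge i = inner_edge j \<longleftrightarrow> i = j"
  by (auto simp: inner_edge_def doubleton_eq_iff)

lemma outer_edge_eq_iff [simp]: "outer_edge i = outer_edge j \<longleftrightarrow> i = j"
  by (auto simp: outer_edge_def doubleton_eq_iff)

lemma inner_edge_neq_outer_edge [simp]: "inner_edge i \<noteq> outer_edge j" "outer_edge j \<noteq> inner_edge i"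
  by (auto simp: inner_edge_def outer_edge_def doubleton_eq_iff)

definition crosses :: "('a \<Rightarrow> plane) \<Rightarrow> 'a set \<Rightarrow> 'a set \<Rightarrow> bool" where
  "crosses pos e f \<longleftrightarrow>
     edge_interior pos (straight_edge pos) e \<inter> edge_interior pos (straight_edge pos) f \<noteq> {}"

lemma crosses_sym: "crosses pos e f \<longleftrightarrow> crosses pos f e"
  by (auto simp: crosses_def)

text \<open>The common endpoint already is the single point that two edges may share, and it does
  not belong to the interiors.\<close>

lemma adjacent_not_crosses:
  assumes "rectilinear_drawing G pos" "e \<in> edges G" "f \<in> edges G" "e \<noteq> f" "v \<in> e" "v \<in> f"
  shows "\<not> crosses pos e f"
proof -
  obtain p where "straight_edge pos e \<inter> straight_edge pos f \<subseteq> {p}"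
    using assms unfolding rectilinear_drawing_def good_drawing_def by meson
  moreover have "pos v \<in> straight_edge pos e \<inter> straight_edge pos f"
    using assms(5,6) by (auto simp: straight_edge_def intro: hull_inc)
  ultimately show ?thesis
    using assms(5,6) unfolding crosses_def edge_interior_def by blast
qed

section \<open>Counting crossings by pairs of legs\<close>

definition index_pairs :: "nat \<Rightarrow> (nat \<times> nat) set" where
  "index_pairs k = {(i, j). i < j \<and> j < k}"

lemma finite_index_pairs [simp]: "finite (index_pairs k)"
  by (rule finite_subset[of _ "{..<k} \<times> {..<k}"]) (auto simp: index_pairs_def)

lemma card_index_pairs: "card (index_pairs k) = k choose 2"
proof (induction k)
  case (Suc k)
  have "index_pairs (Suc k) = index_pairs k \<union> (\<lambda>i. (i, k)) ` {..<k}"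
    by (auto simp: index_pairs_def)
  moreover have "index_pairs k \<inter> (\<lambda>i. (i, k)) ` {..<k} = {}"
    by (auto simp: index_pairs_def)
  ultimately have "card (index_pairs (Suc k)) = card (index_pairs k) + k"
    by (simp add: card_Un_disjoint card_image inj_on_def)
  then show ?case
    using Suc by (simp add: numeral_2_eq_2)
qed (auto simp: index_pairs_def)

text \<open>The sum \<open>card U + card V\<close> is regrouped so that every summand counts pairs
  of legs: \<open>U \<inter> V\<close> collects the mutually crossing pairs, for which a sharper
  bound than \<open>k choose 2\<close> is available.\<close>

lemma crossings_spider2:
  assumes "rectilinear_drawing (spider k 2) pos"
  defines "U \<equiv> {(i, j) \<in> index_pairs k. crosses pos (inner_edge i) (outer_edge j)}"
  defines "V \<equiv> {(i, j) \<in> index_pairs k. crosses pos (inner_edge j) (outer_edge i)}"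
  shows "crossings (spider k 2) pos =
    card {(i, j) \<in> index_pairs k. crosses pos (outer_edge i) (outer_edge j)} + (card (U \<union> V) + card (U \<inter> V))"
proof -
  define W where "W = {(i, j) \<in> index_pairs k. crosses pos (outer_edge i) (outer_edge j)}"
  define fW where "fW = (\<lambda>(i, j). {outer_edge i, outer_edge j})"
  define fU where "fU = (\<lambda>(i, j). {inner_edge i, outer_edge j})"
  define fV where "fV = (\<lambda>(i, j). {inner_edge j, outer_edge i})"
  let ?X = "{{e, f} | e f. e \<in> edges (spider k 2) \<and> f \<in> edges (spider k 2) \<and> e \<noteq> f \<and>
      crosses pos e f}"
  have nII: "\<not> crosses pos (inner_edge i) (inner_edge j)" if "i < k" "j < k" "i \<noteq> j" for i j
    by (rule adjacent_not_crosses[OF assms(1), of _ _ Center])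
      (use that in \<open>auto simp: edges_spider2\<close>, auto simp: inner_edge_def)
  have nIO: "\<not> crosses pos (inner_edge i) (outer_edge i)" if "i < k" for i
    by (rule adjacent_not_crosses[OF assms(1), of _ _ "Leg i 1"])
      (use that in \<open>auto simp: edges_spider2\<close>, auto simp: inner_edge_def outer_edge_def)
  have OO: "{outer_edge i, outer_edge j} \<in> fW ` W"
    if "i < k" "j < k" "i \<noteq> j" "crosses pos (outer_edge i) (outer_edge j)" for i j
  proof (cases "i < j")
    case True
    then have "(i, j) \<in> W" using that by (auto simp: W_def index_pairs_def)
    then show ?thesis by (force simp: fW_def)
  next
    case False
    then have "(j, i) \<in> W" using that crosses_sym by (auto simp: W_def index_pairs_def)
    then show ?thesis by (force simp: fW_def)
  qed
  have IO: "{inner_edge i, outer_edge j} \<in> fU ` U \<union> fV ` V"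
    if ij: "i < k" "j < k" "crosses pos (inner_edge i) (outer_edge j)" for i j
  proof -
    have "i \<noteq> j" using nIO ij by auto
    then consider "(i, j) \<in> U" | "(j, i) \<in> V"
      using ij by (force simp: U_def V_def index_pairs_def)
    then show ?thesis by cases (force simp: fU_def fV_def)+
  qed
  have X: "?X = fW ` W \<union> (fU ` U \<union> fV ` V)"
  proof
    show "?X \<subseteq> fW ` W \<union> (fU ` U \<union> fV ` V)"
    proof
      fix x assume "x \<in> ?X"
      then obtain e f where x: "x = {e, f}" "e \<in> edges (spider k 2)" "f \<in> edges (spider k 2)"
        "e \<noteq> f" "crosses pos e f" by blast
      then consider
          i j where "e = inner_edge i" "f = inner_edge j" "i < k" "j < k"
        | i j where "e = inner_edge i" "f = outer_edge j" "i < k" "j < k"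
        | i j where "e = outer_edge i" "f = inner_edge j" "i < k" "j < k"
        | i j where "e = outer_edge i" "f = outer_edge j" "i < k" "j < k"
        unfolding edges_spider2 by blast
      then show "x \<in> fW ` W \<union> (fU ` U \<union> fV ` V)"
      proof cases
        case 1
        then show ?thesis using x nII by auto
      next
        case 2
        then show ?thesis using x IO by simp
      next
        case 3
        then show ?thesis using x IO[of j i] by (simp add: crosses_sym insert_commute)
      next
        case 4
        then show ?thesis using x OO by simp
      qed
    qed
    show "fW ` W \<union> (fU ` U \<union> fV ` V) \<subseteq> ?X"
    proof
      fix x assume "x \<in> fW ` W \<union> (fU ` U \<union> fV ` V)"
      then consider
          i j where "x = {outer_edge i, outer_edge j}" "i < j" "j < k" "crosses pos (outer_edge i) (outer_edge j)"
        | i j where "x = {inner_edge i, outer_edge j}" "i < k" "j < k" "crosses pos (inner_edge i) (outer_edge j)"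
        unfolding W_def U_def V_def fW_def fU_def fV_def index_pairs_def
        by (elim UnE imageE) (auto dest: less_trans)
      then show "x \<in> ?X"
      proof cases
        case 1
        then have "outer_edge i \<in> edges (spider k 2)" "outer_edge j \<in> edges (spider k 2)"
          "outer_edge i \<noteq> outer_edge j"
          by (auto simp: edges_spider2)
        then show ?thesis using 1 by blast
      next
        case 2
        then have "inner_edge i \<in> edges (spider k 2)" "outer_edge j \<in> edges (spider k 2)"
          "inner_edge i \<noteq> outer_edge j"
          by (auto simp: edges_spider2)
        then show ?thesis using 2 by blast
      qed
    qed
  qed
  have fin: "finite W" "finite U" "finite V"
    unfolding W_def U_def V_def by (rule finite_subset[OF _ finite_index_pairs[of k]]; blast)+
  have inj: "inj_on fW W" "inj_on fU U" "inj_on fV V"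
    unfolding inj_on_def W_def fW_def fU_def fV_def index_pairs_def
    by (auto simp: doubleton_eq_iff)
  \<comment> \<open>Since \<open>i < j\<close>, the inner edge has the smaller index in
    \<open>fU\<close> and the larger one in \<open>fV\<close>, so no pair of edges is counted
    twice.\<close>
  have "fW ` W \<inter> (fU ` U \<union> fV ` V) = {}" "fU ` U \<inter> fV ` V = {}"
    by (auto simp: fW_def fU_def fV_def U_def V_def index_pairs_def doubleton_eq_iff)
  then have "card ?X = card W + (card U + card V)"
    unfolding X using fin inj by (simp add: card_Un_disjoint card_image)
  moreover have "card U + card V = card (U \<union> V) + card (U \<inter> V)"
    using card_Un_Int fin by blast
  ultimately show ?thesis
    unfolding crossings_def W_def crosses_def by simp
qed

section \<open>The upper bound\<close>

definition det2 :: "plane \<Rightarrow> plane \<Rightarrow> real" where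
  "det2 p q = fst p * snd q - snd p * fst q"

lemma det2_eq_0_imp_scaleR:
  assumes "det2 p q = 0" "p \<noteq> 0"
  obtains l where "q = l *\<^sub>R p"
proof (cases "fst p = 0")
  case True
  then have "snd p \<noteq> 0" "fst q = 0" using assms by (auto simp: det2_def prod_eq_iff)
  then show ?thesis using True that[of "snd q / snd p"] by (simp add: prod_eq_iff)
next
  case False
  then show ?thesis using assms that[of "fst q / fst p"]
    by (simp add: prod_eq_iff det2_def field_simps)
qed

lemma straight_inner: "straight_edge pos (inner_edge i) = closed_segment (pos Center) (pos (Leg i 1))"
  and straight_outer: "straight_edge pos (outer_edge i) = closed_segment (pos (Leg i 1)) (pos (Leg i 2))"
  by (simp_all add: straight_edge_def inner_edge_def outer_edge_def segment_convex_hull)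

text \<open>Vectors are taken from the center so that applying \<open>det2 (A j)\<close> to the
  relation removes the term with \<open>A j\<close> and ties the turn of leg \<open>j\<close> to
  \<open>det2 (A j) (A i)\<close>.\<close>

lemma crosses_inner_outerE:
  fixes pos :: "spider_vertex \<Rightarrow> plane"
  defines "A \<equiv> \<lambda>i. pos (Leg i 1) - pos Center"
    and "B \<equiv> \<lambda>i. pos (Leg i 2) - pos Center"
  assumes "crosses pos (inner_edge i) (outer_edge j)"
  obtains t s where "0 < t" "0 < s" "s < 1" "t *\<^sub>R A i = (1 - s) *\<^sub>R A j + s *\<^sub>R B j"
proof -
  obtain p where p: "p \<in> closed_segment (pos Center) (pos (Leg i 1))" "p \<noteq> pos Center"
      "p \<in> closed_segment (pos (Leg j 1)) (pos (Leg j 2))" "p \<noteq> pos (Leg j 1)" "p \<noteq> pos (Leg j 2)"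
    using assms(3) unfolding crosses_def edge_interior_def straight_inner straight_outer
    by (auto simp: inner_edge_def outer_edge_def)
  obtain t where t: "0 \<le> t" "p = (1 - t) *\<^sub>R pos Center + t *\<^sub>R pos (Leg i 1)"
    using p(1) unfolding in_segment by auto
  obtain s where s: "0 \<le> s" "s \<le> 1" "p = (1 - s) *\<^sub>R pos (Leg j 1) + s *\<^sub>R pos (Leg j 2)"
    using p(3) unfolding in_segment by auto
  have "t \<noteq> 0" "s \<noteq> 0" "s \<noteq> 1" using t s p by auto
  moreover have "t *\<^sub>R A i = p - pos Center"
    unfolding t(2) by (simp add: A_def algebra_simps)
  moreover have "(1 - s) *\<^sub>R A j + s *\<^sub>R B j = p - pos Center"
    unfolding s(3) by (simp add: A_def B_def algebra_simps)
  ultimately show ?thesis using that t s by (metis order_le_less)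
qed

text \<open>The sign of \<open>det2 (A i) (B i)\<close> is the turning direction of leg
  \<open>i\<close>. By the two crossing relations it is the sign of \<open>det2 (A i) (A j)\<close>
  for leg \<open>i\<close> and of \<open>det2 (A j) (A i)\<close> for leg \<open>j\<close>; these
  are opposite once parallel inner edges are excluded.\<close>

lemma mutual_crossing_opposite_turns:
  fixes pos :: "spider_vertex \<Rightarrow> plane"
  defines "A \<equiv> \<lambda>i. pos (Leg i 1) - pos Center"
    and "B \<equiv> \<lambda>i. pos (Leg i 2) - pos Center"
  assumes draw: "rectilinear_drawing (spider k 2) pos"
    and ij: "i < k" "j < k" "i \<noteq> j"
    and "crosses pos (inner_edge i) (outer_edge j)" "crosses pos (inner_edge j) (outer_edge i)"
  shows "det2 (A i) (B i) * det2 (A j) (B j) < 0"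
proof -
  obtain t s where ts: "0 < t" "0 < s" "s < 1" "t *\<^sub>R A i = (1 - s) *\<^sub>R A j + s *\<^sub>R B j"
    using crosses_inner_outerE[OF assms(7)] unfolding A_def B_def by metis
  obtain t' s' where ts': "0 < t'" "0 < s'" "s' < 1" "t' *\<^sub>R A j = (1 - s') *\<^sub>R A i + s' *\<^sub>R B i"
    using crosses_inner_outerE[OF assms(8)] unfolding A_def B_def by metis
  have inj: "inj_on pos (verts (spider k 2))"
    using draw unfolding rectilinear_drawing_def good_drawing_def by blast
  have neq: "pos (Leg i 1) \<noteq> pos Center" "pos (Leg j 1) \<noteq> pos Center" "pos (Leg j 2) \<noteq> pos Center"
    using inj_on_eq_iff[OF inj] ij by (auto simp: verts_spider2)
  have "det2 (A i) (A j) \<noteq> 0"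
  proof
    assume "det2 (A i) (A j) = 0"
    moreover have "A i \<noteq> 0" using neq by (simp add: A_def)
    ultimately obtain l where l: "A j = l *\<^sub>R A i" using det2_eq_0_imp_scaleR by blast
    have "l \<noteq> 0" using l neq by (auto simp: A_def)
    then consider "l > 0" | "l < 0" by linarith
    then show False
    proof cases
      case 1
      \<comment> \<open>Both inner edges lie on one ray, so the end of the shorter one is a second
        common point besides the center.\<close>
      define m where "m = min 1 l"
      have m: "0 < m" "m \<le> 1" "m \<le> l" using 1 by (auto simp: m_def)
      let ?q = "pos Center + m *\<^sub>R A i"
      have "?q \<in> straight_edge pos (inner_edge i)"
        unfolding straight_inner in_segment using m
        by (intro exI[of _ m]) (simp add: A_def algebra_simps)
      moreover have "?q = pos Center + (m / l) *\<^sub>R A j" using l 1 by simp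
      then have "?q \<in> straight_edge pos (inner_edge j)"
        unfolding straight_inner in_segment using m 1
        by (intro exI[of _ "m / l"]) (simp add: A_def algebra_simps)
      moreover have "pos Center \<in> straight_edge pos (inner_edge i)" "pos Center \<in> straight_edge pos (inner_edge j)"
        by (simp_all add: straight_inner)
      moreover have "?q \<noteq> pos Center" using m \<open>A i \<noteq> 0\<close> by simp
      moreover have "\<exists>p. straight_edge pos (inner_edge i) \<inter> straight_edge pos (inner_edge j) \<subseteq> {p}"
        using draw ij unfolding rectilinear_drawing_def good_drawing_def edges_spider2 by simp
      ultimately show False by blast
    next
      case 2
      \<comment> \<open>In multiples of \<open>A i\<close>, outer edge \<open>j\<close> runs from
        \<open>l < 0\<close> at parameter 0 to \<open>t > 0\<close> at parameter \<open>s\<close>;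
        \<open>u\<close> is the parameter at which it would pass through the center, which a good
        drawing forbids.\<close>
      define u where "u = - l * s / (t - l)"
      have "t - l > 0" using 2 ts by simp
      have "- l * s \<le> - l" using 2 ts by (simp add: mult_le_cancel_left1)
      then have "l - t \<le> l * s" using ts by simp
      then have u: "0 \<le> u" "u \<le> 1"
        unfolding u_def using 2 ts \<open>t - l > 0\<close> by (simp_all add: divide_simps mult_nonpos_nonneg)
      have Bj: "B j = ((t - (1 - s) * l) / s) *\<^sub>R A i"
      proof -
        have "s *\<^sub>R B j = (t - (1 - s) * l) *\<^sub>R A i"
          using ts(4) l by (simp add: algebra_simps)
        then have "(1/s) *\<^sub>R (s *\<^sub>R B j) = (1/s) *\<^sub>R ((t - (1 - s) * l) *\<^sub>R A i)" by simp
        then show ?thesis using ts(2) by simp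
      qed
      have "(1 - u) * l + u * ((t - (1 - s) * l) / s) = 0"
        unfolding u_def using ts \<open>t - l > 0\<close> by (simp add: field_simps)
      then have "(1 - u) *\<^sub>R A j + u *\<^sub>R B j = 0"
        unfolding l Bj by (metis scaleR_left.add scaleR_scaleR scaleR_zero_left)
      then have "pos Center = (1 - u) *\<^sub>R pos (Leg j 1) + u *\<^sub>R pos (Leg j 2)"
        by (simp add: A_def B_def algebra_simps)
      then have "pos Center \<in> straight_edge pos (outer_edge j)"
        unfolding straight_outer in_segment using u by blast
      then have "pos Center \<in> edge_interior pos (straight_edge pos) (outer_edge j)"
        using neq by (auto simp: edge_interior_def outer_edge_def)
      moreover have "pos Center \<notin> edge_interior pos (straight_edge pos) (outer_edge j)"
        using draw ij
        unfolding rectilinear_drawing_def good_drawing_def edges_spider2 verts_spider2 by blast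
      ultimately show False by blast
    qed
  qed
  moreover have "t * det2 (A j) (A i) = s * det2 (A j) (B j)"
  proof -
    have "det2 (A j) (t *\<^sub>R A i) = s * det2 (A j) (B j)"
      unfolding ts(4) by (simp add: det2_def algebra_simps)
    then show ?thesis by (simp add: det2_def algebra_simps)
  qed
  moreover have "t' * det2 (A i) (A j) = s' * det2 (A i) (B i)"
  proof -
    have "det2 (A i) (t' *\<^sub>R A j) = s' * det2 (A i) (B i)"
      unfolding ts'(4) by (simp add: det2_def algebra_simps)
    then show ?thesis by (simp add: det2_def algebra_simps)
  qed
  ultimately have eqs: "det2 (A j) (B j) = - (t / s) * det2 (A i) (A j)"
      "det2 (A i) (B i) = t' / s' * det2 (A i) (A j)"
    using ts(2) ts'(2) by (simp_all add: field_simps det2_def)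
  have "0 < (t' / s') * (t / s) * (det2 (A i) (A j))\<^sup>2"
    using ts ts' \<open>det2 (A i) (A j) \<noteq> 0\<close> by simp
  then show ?thesis unfolding eqs by (simp add: power2_eq_square algebra_simps)
qed

section \<open>Bounding the number of mutually crossing pairs\<close>

lemma mult_le_square_div_4:
  fixes a b k :: nat
  assumes "a + b \<le> k"
  shows "a * b \<le> k * k div 4"
proof -
  have "4 * (int a * int b) \<le> (int a + int b)\<^sup>2"
    using zero_le_power2[of "int a - int b"] by (simp add: power2_eq_square algebra_simps)
  also have "\<dots> \<le> (int k)\<^sup>2"
    using assms by (intro power_mono) auto
  finally have "int (4 * (a * b)) \<le> int (k * k)" by (simp add: power2_eq_square)
  then have "4 * (a * b) \<le> k * k" by linarith
  then show ?thesis by linarith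
qed

lemma crossings_spider2_le:
  assumes "rectilinear_drawing (spider k 2) pos"
  shows "crossings (spider k 2) pos \<le> 2 * (k choose 2) + k * k div 4"
proof -
  define U where "U = {(i, j) \<in> index_pairs k. crosses pos (inner_edge i) (outer_edge j)}"
  define V where "V = {(i, j) \<in> index_pairs k. crosses pos (inner_edge j) (outer_edge i)}"
  define W where "W = {(i, j) \<in> index_pairs k. crosses pos (outer_edge i) (outer_edge j)}"
  define d where "d i = det2 (pos (Leg i 1) - pos Center) (pos (Leg i 2) - pos Center)" for i
  define P where "P = {i. i < k \<and> 0 < d i}"
  define N where "N = {i. i < k \<and> d i < 0}"
  have fin: "finite P" "finite N" by (auto simp: P_def N_def)
  have dd: "d i * d j < 0" if "(i, j) \<in> U \<inter> V" for i j
    using mutual_crossing_opposite_turns[OF assms, of i j] that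
    by (auto simp: d_def U_def V_def index_pairs_def)
  have "card (U \<inter> V) \<le> card (P \<times> N)"
  proof (rule card_inj_on_le)
    \<comment> \<open>A mutually crossing pair is sent to its leg of positive turn followed by its
      leg of negative turn; as \<open>i < j\<close> in every pair, the reordering loses
      nothing.\<close>
    let ?f = "\<lambda>(i, j). if 0 < d i then (i, j) else (j, i)"
    show "inj_on ?f (U \<inter> V)"
      by (auto simp: inj_on_def U_def index_pairs_def split: if_splits)
    show "?f ` (U \<inter> V) \<subseteq> P \<times> N"
    proof (rule image_subsetI)
      fix x assume "x \<in> U \<inter> V"
      moreover obtain i j where x: "x = (i, j)" by (cases x)
      ultimately have "d i * d j < 0" "i < k" "j < k" using dd by (auto simp: U_def index_pairs_def)
      then show "?f x \<in> P \<times> N"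
        by (auto simp: x P_def N_def mult_less_0_iff)
    qed
  qed (use fin in auto)
  also have "\<dots> \<le> k * k div 4"
  proof -
    have "card P + card N = card (P \<union> N)"
      using fin by (intro card_Un_disjoint[symmetric]) (auto simp: P_def N_def)
    also have "\<dots> \<le> card {..<k}" by (rule card_mono) (auto simp: P_def N_def)
    finally show ?thesis using mult_le_square_div_4 by (simp add: card_cartesian_product)
  qed
  finally have "card (U \<inter> V) \<le> k * k div 4" .
  moreover have "card W \<le> k choose 2" "card (U \<union> V) \<le> k choose 2"
    unfolding card_index_pairs[symmetric]
    by (rule card_mono; auto simp: U_def V_def W_def)+
  moreover have "crossings (spider k 2) pos = card W + (card (U \<union> V) + card (U \<inter> V))"
    using crossings_spider2[OF assms] unfolding U_def V_def W_def by blast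
  ultimately show ?thesis by linarith
qed

section \<open>A drawing attaining the bound\<close>

text \<open>The projective map $[x : y : 1] \mapsto [x : 1 : y]$, which sends the half plane above the
  $x$-axis to itself and the point at infinity of the upward vertical rays to the origin.\<close>

definition proj_point :: "real \<Rightarrow> real \<Rightarrow> plane" where
  "proj_point x h = (x / h, 1 / h)"

section \<open>Images of vertical rays and segments under the projective map\<close>

lemma proj_point_eq_iff:
  assumes "h > 0" "h' > 0"
  shows "proj_point x h = proj_point x' h' \<longleftrightarrow> x = x' \<and> h = h'"
  using assms by (auto simp: proj_point_def field_simps)

lemma proj_point_neq_0: "h > 0 \<Longrightarrow> proj_point x h \<noteq> 0"
  by (auto simp: proj_point_def prod_eq_iff)

text \<open>Scaling \<open>proj_point x h\<close> by \<open>u\<close> replaces the height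
  \<open>h\<close> by \<open>h / u\<close>, so the segment to the origin is the image of an upward
  vertical ray.\<close>

lemma closed_segment_0_proj_point:
  assumes "h > 0"
  shows "closed_segment 0 (proj_point x h) = insert 0 (proj_point x ` {h..})"
proof (intro equalityI subsetI)
  fix p assume "p \<in> closed_segment 0 (proj_point x h)"
  then obtain u where u: "0 \<le> u" "u \<le> 1" "p = u *\<^sub>R proj_point x h"
    unfolding in_segment by auto
  show "p \<in> insert 0 (proj_point x ` {h..})"
  proof (cases "u = 0")
    case False
    then have "p = proj_point x (h / u)" "h \<le> h / u"
      using u assms by (auto simp: proj_point_def field_simps)
    then show ?thesis by auto
  qed (use u in auto)
next
  fix p assume "p \<in> insert 0 (proj_point x ` {h..})"
  then consider "p = 0" | h' where "h \<le> h'" "p = proj_point x h'" by auto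
  then show "p \<in> closed_segment 0 (proj_point x h)"
  proof cases
    case 2
    then have "p = (1 - h / h') *\<^sub>R 0 + (h / h') *\<^sub>R proj_point x h" "0 \<le> h / h'" "h / h' \<le> 1"
      using assms by (auto simp: proj_point_def field_simps)
    then show ?thesis unfolding in_segment by blast
  qed auto
qed

lemma convex_combination_pos:
  fixes a b u :: real
  assumes "0 < a" "0 < b" "0 \<le> u" "u \<le> 1"
  shows "0 < (1 - u) * a + u * b"
  using assms by (cases "u = 1") (auto intro: add_pos_nonneg)

text \<open>A projective map sends lines to lines but does not keep affine parameters: the endpoints
  are reweighted by their heights.\<close>

lemma closed_segment_proj_point:
  fixes a b x y :: real
  defines "l \<equiv> \<lambda>x. a * x + b"
  assumes "l x > 0" "l y > 0"
  shows "closed_segment (proj_point x (l x)) (proj_point y (l y)) =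
    (\<lambda>z. proj_point z (l z)) ` closed_segment x y"
proof (intro equalityI subsetI)
  fix p assume "p \<in> closed_segment (proj_point x (l x)) (proj_point y (l y))"
  then obtain u where u: "0 \<le> u" "u \<le> 1"
    "p = (1 - u) *\<^sub>R proj_point x (l x) + u *\<^sub>R proj_point y (l y)"
    unfolding in_segment by auto
  \<comment> \<open>The second coordinate of \<open>p\<close> is \<open>w / (l x * l y)\<close>, and
    \<open>v\<close> is the parameter of the preimage of \<open>p\<close> between \<open>x\<close>
    and \<open>y\<close>.\<close>
  define w where "w = (1 - u) * l y + u * l x"
  define v where "v = u * l x / w"
  have "w > 0"
    unfolding w_def using convex_combination_pos u assms by simp
  have "1 - v = (1 - u) * l y / w"
    using \<open>w > 0\<close> by (simp add: v_def w_def field_simps)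
  then have "0 \<le> v" "0 \<le> 1 - v"
    using u assms \<open>w > 0\<close> by (simp_all add: v_def)
  define z where "z = (1 - v) * x + v * y"
  have z: "z = ((1 - u) * l y * x + u * l x * y) / w"
    unfolding z_def \<open>1 - v = _\<close> unfolding v_def using \<open>w > 0\<close> by (simp add: field_simps)
  have lz: "l z = l x * l y / w"
  proof -
    have "l z = (1 - v) * l x + v * l y"
      by (simp add: z_def l_def algebra_simps)
    also have "\<dots> = ((1 - u) * l y * l x + u * l x * l y) / w"
      unfolding \<open>1 - v = _\<close> unfolding v_def using \<open>w > 0\<close> by (simp add: field_simps)
    also have "\<dots> = l x * l y / w" by (simp add: algebra_simps)
    finally show ?thesis .
  qed
  have zw: "z * w = (1 - u) * l y * x + u * l x * y"
    using z \<open>w > 0\<close> by simp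
  have "proj_point z (l z) = (z * w / (l x * l y), w / (l x * l y))"
    unfolding proj_point_def lz by simp
  also have "\<dots> = p"
    unfolding zw u(3) unfolding w_def proj_point_def using assms(2,3) by (simp add: field_simps)
  finally have "p = proj_point z (l z)" by simp
  moreover have "z \<in> closed_segment x y"
    unfolding in_segment using \<open>0 \<le> v\<close> \<open>0 \<le> 1 - v\<close> by (intro exI[of _ v]) (simp add: z_def)
  ultimately show "p \<in> (\<lambda>z. proj_point z (l z)) ` closed_segment x y" by blast
next
  fix p assume "p \<in> (\<lambda>z. proj_point z (l z)) ` closed_segment x y"
  then obtain z where z: "z \<in> closed_segment x y" "p = proj_point z (l z)" by blast
  from z(1) obtain v where "0 \<le> v" "v \<le> 1" "z = (1 - v) * x + v * y"
    unfolding in_segment by auto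
  with z(2) have v: "0 \<le> v" "v \<le> 1"
    "p = proj_point ((1 - v) * x + v * y) (l ((1 - v) * x + v * y))" by simp_all
  define h where "h = (1 - v) * l x + v * l y"
  have h: "l ((1 - v) * x + v * y) = h"
    by (simp add: h_def l_def algebra_simps)
  have "h > 0"
    unfolding h_def using convex_combination_pos v assms by simp
  \<comment> \<open>This inverts the change of parameter from the first half.\<close>
  define u where "u = v * l y / h"
  have "1 - u = (1 - v) * l x / h"
    using \<open>h > 0\<close> by (simp add: u_def h_def field_simps)
  then have "0 \<le> u" "0 \<le> 1 - u"
    using v assms \<open>h > 0\<close> by (simp_all add: u_def)
  moreover have "p = (1 - u) *\<^sub>R proj_point x (l x) + u *\<^sub>R proj_point y (l y)"
    unfolding v(3) h \<open>1 - u = _\<close> unfolding u_def proj_point_def using assms(2,3) \<open>h > 0\<close>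
    by (simp add: field_simps)
  ultimately show "p \<in> closed_segment (proj_point x (l x)) (proj_point y (l y))"
    unfolding in_segment by (intro exI[of _ u]) simp
qed

section \<open>Feet and tips on the tangents of a parabola\<close>

context
  fixes k r :: nat
  assumes r: "r \<le> k" and k: "0 < k"
begin

text \<open>Up to the shift by $8k^2$, which makes all relevant heights positive, these are the tangents
  to the parabola $y = x^2$ at $x = i$; hence no three of them are concurrent, and those at $i$ and
  $j$ meet at $x = (i + j) / 2$.\<close>

definition tangent :: "nat \<Rightarrow> real \<Rightarrow> real" where
  "tangent i x = 2 * real i * x + (8 * (real k)\<^sup>2 - (real i)\<^sup>2)"

text \<open>Feet avoid the open strip between 0 and \<open>k\<close>, which contains all
  intersections of the tangents. On the right of it the steeper of two tangents is higher and starts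
  farther out, on the left the flatter one; so the higher tangent passes over the foot nearer to the
  strip.\<close>

definition foot :: "nat \<Rightarrow> real" where
  "foot i = (if i < r then real k + real i else real i - real k)"

text \<open>Feet stay within \<open>2 * k\<close> of 0, so each tip lies beyond all feet, on the
  side of the strip opposite to the foot of its own leg.\<close>

definition tip :: "nat \<Rightarrow> real" where
  "tip i = (if i < r then - 3 * real k else 3 * real k)"

definition spider_pos :: "spider_vertex \<Rightarrow> plane" where
  "spider_pos v = (case v of Center \<Rightarrow> 0
     | Leg i j \<Rightarrow> if j = 1 then proj_point (foot i) (tangent i (foot i))
                 else proj_point (tip i) (tangent i (tip i)))"

lemma spider_pos_simps:
  "spider_pos Center = 0"
  "spider_pos (Leg i 1) = proj_point (foot i) (tangent i (foot i))"
  "spider_pos (Leg i (Suc 0)) = proj_point (foot i) (tangent i (foot i))"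
  "spider_pos (Leg i 2) = proj_point (tip i) (tangent i (tip i))"
  by (simp_all add: spider_pos_def)

text \<open>The factorisation shows both where two tangents meet and which one is higher on either
  side.\<close>

lemma tangent_diff: "tangent j x - tangent i x = (real j - real i) * (2 * x - (real i + real j))"
  by (simp add: tangent_def power2_eq_square algebra_simps)

lemma tangent_eq_iff: "tangent i x = tangent j x \<longleftrightarrow> i = j \<or> 2 * x = real i + real j"
  using tangent_diff[of j x i] by auto

lemma tangent_less_iff:
  assumes "i < j"
  shows "tangent i x < tangent j x \<longleftrightarrow> real i + real j < 2 * x"
    and "tangent j x < tangent i x \<longleftrightarrow> 2 * x < real i + real j"
  using tangent_diff[of j x i] assms
  by (smt (verit) of_nat_less_iff zero_less_mult_iff mult_less_0_iff)+

text \<open>The terms \<open>2 * i * x\<close> and \<open>i\<close> squared are at most six times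
  and once \<open>k\<close> squared in absolute value; the shift by eight times \<open>k\<close>
  squared outweighs them.\<close>

lemma tangent_pos:
  assumes "i < k" "\<bar>x\<bar> \<le> 3 * real k"
  shows "tangent i x > 0"
proof -
  have "\<bar>2 * real i * x\<bar> \<le> (2 * real k) * (3 * real k)"
    unfolding abs_mult using assms by (intro mult_mono) auto
  moreover have "(real i)\<^sup>2 \<le> (real k)\<^sup>2"
    using assms by (intro power_mono) auto
  moreover have "(real k)\<^sup>2 > 0" using k by simp
  ultimately show ?thesis
    unfolding tangent_def by (simp add: power2_eq_square)
qed

lemma foot_bound: "i < k \<Longrightarrow> foot i < 0 \<or> real k \<le> foot i" "i < k \<Longrightarrow> \<bar>foot i\<bar> < 2 * real k"
  using r by (auto simp: foot_def)

lemma foot_eq_iff: "i < k \<Longrightarrow> j < k \<Longrightarrow> foot i = foot j \<longleftrightarrow> i = j"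
  by (auto simp: foot_def)

lemma abs_tip: "\<bar>tip i\<bar> = 3 * real k"
  by (simp add: tip_def)

lemma foot_neq_tip: "i < k \<Longrightarrow> foot i \<noteq> tip j"
  using foot_bound(2)[of i] abs_tip[of j] by fastforce

text \<open>Before projection, middle vertices and inner edges have the abscissas of feet, so this
  keeps them off the crossings of outer edges.\<close>

lemma foot_neq_mid: "i < k \<Longrightarrow> j < k \<Longrightarrow> l < k \<Longrightarrow> 2 * foot l \<noteq> real i + real j"
  using foot_bound(1)[of l] by fastforce

lemma tip_neq_mid: "i < k \<Longrightarrow> j < k \<Longrightarrow> 2 * tip l \<noteq> real i + real j"
  by (auto simp: tip_def)

lemma closed_segment_bound:
  assumes "i < k" "x \<in> closed_segment (foot i) (tip i)"
  shows "\<bar>x\<bar> \<le> 3 * real k"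
  using assms foot_bound(2)[of i] abs_tip[of i]
  by (auto simp: closed_segment_eq_real_ivl split: if_splits)

lemma tangent_foot_pos: "i < k \<Longrightarrow> j < k \<Longrightarrow> tangent i (foot j) > 0"
  and tangent_tip_pos: "i < k \<Longrightarrow> tangent i (tip j) > 0"
  using tangent_pos foot_bound(2)[of j] abs_tip[of j] by auto

section \<open>Edges as images of vertical rays and pieces of tangents\<close>

lemma inner_edge_image:
  assumes "i < k"
  shows "straight_edge spider_pos (inner_edge i) =
    insert 0 (proj_point (foot i) ` {tangent i (foot i)..})"
  using closed_segment_0_proj_point tangent_foot_pos assms
  by (simp add: straight_inner spider_pos_simps)

lemma outer_edge_image:
  assumes "i < k"
  shows "straight_edge spider_pos (outer_edge i) =
    (\<lambda>x. proj_point x (tangent i x)) ` closed_segment (foot i) (tip i)"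
  using closed_segment_proj_point[of "2 * real i" "foot i" "8 * (real k)\<^sup>2 - (real i)\<^sup>2" "tip i"]
    tangent_foot_pos[OF assms assms] tangent_tip_pos[OF assms]
  by (simp add: straight_outer spider_pos_simps tangent_def)

lemma inner_edge_interior:
  assumes "i < k"
  shows "edge_interior spider_pos (straight_edge spider_pos) (inner_edge i) =
    proj_point (foot i) ` {tangent i (foot i)<..}"
proof -
  let ?T = "tangent i (foot i)"
  have "?T > 0" using assms tangent_foot_pos by blast
  then have inj: "inj_on (proj_point (foot i)) {?T..}" and nz: "0 \<notin> proj_point (foot i) ` {?T..}"
    using proj_point_neq_0 by (auto simp: inj_on_def proj_point_eq_iff)
  have "insert 0 (proj_point (foot i) ` {?T..}) - {0, proj_point (foot i) ?T} =
      proj_point (foot i) ` {?T..} - proj_point (foot i) ` {?T}"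
    using nz by blast
  also have "\<dots> = proj_point (foot i) ` ({?T..} - {?T})"
    using inj_on_image_set_diff[OF inj, of "{?T..}" "{?T}"] by simp
  also have "{?T..} - {?T} = {?T<..}" by auto
  finally show ?thesis
    unfolding edge_interior_def inner_edge_image[OF assms]
    by (simp add: inner_edge_def spider_pos_simps)
qed

lemma outer_edge_interior:
  assumes "i < k"
  shows "edge_interior spider_pos (straight_edge spider_pos) (outer_edge i) =
    (\<lambda>x. proj_point x (tangent i x)) ` open_segment (foot i) (tip i)"
proof -
  have "proj_point x (tangent i x) = proj_point y (tangent i y) \<longleftrightarrow> x = y"
    if "x \<in> closed_segment (foot i) (tip i)" "y \<in> closed_segment (foot i) (tip i)" for x y
    using that closed_segment_bound[OF assms] tangent_pos[OF assms] by (auto simp: proj_point_eq_iff)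
  then have "inj_on (\<lambda>x. proj_point x (tangent i x)) (closed_segment (foot i) (tip i))"
    by (simp add: inj_on_def)
  from inj_on_image_set_diff[OF this, of "closed_segment (foot i) (tip i)" "{foot i, tip i}"]
  show ?thesis
    unfolding edge_interior_def outer_edge_image[OF assms] open_segment_def
    by (simp add: outer_edge_def spider_pos_simps)
qed

section \<open>The placement is a good drawing\<close>

lemma inner_Int_inner:
  assumes "i < k" "j < k" "i \<noteq> j"
  shows "straight_edge spider_pos (inner_edge i) \<inter> straight_edge spider_pos (inner_edge j) \<subseteq> {0}"
  using assms tangent_foot_pos[of i i] tangent_foot_pos[of j j]
  by (auto simp: inner_edge_image proj_point_eq_iff foot_eq_iff)

text \<open>Before projection, a vertical ray meets a tangent at most once, and
  \<open>proj_point\<close> is injective at positive heights. The center comes from infinity and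
  lies on no outer edge.\<close>

lemma inner_Int_outer:
  assumes "i < k" "j < k"
  shows "straight_edge spider_pos (inner_edge i) \<inter> straight_edge spider_pos (outer_edge j)
    \<subseteq> {proj_point (foot i) (tangent j (foot i))}"
proof
  fix p assume p: "p \<in> straight_edge spider_pos (inner_edge i) \<inter> straight_edge spider_pos (outer_edge j)"
  then obtain x where x: "x \<in> closed_segment (foot j) (tip j)" "p = proj_point x (tangent j x)"
    using assms by (auto simp: outer_edge_image)
  have "tangent j x > 0" using x closed_segment_bound tangent_pos assms by blast
  moreover obtain h where "h \<ge> tangent i (foot i)" "p = proj_point (foot i) h"
    using p x proj_point_neq_0[OF \<open>tangent j x > 0\<close>, of x] assms by (auto simp: inner_edge_image)
  ultimately have "x = foot i"
    using x tangent_foot_pos[of i i] assms by (simp add: proj_point_eq_iff)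
  then show "p \<in> {proj_point (foot i) (tangent j (foot i))}" using x by simp
qed

lemma outer_Int_outer:
  assumes "i < k" "j < k" "i \<noteq> j"
  defines "m \<equiv> (real i + real j) / 2"
  shows "straight_edge spider_pos (outer_edge i) \<inter> straight_edge spider_pos (outer_edge j)
    \<subseteq> {proj_point m (tangent i m)}"
proof
  fix p assume p: "p \<in> straight_edge spider_pos (outer_edge i) \<inter> straight_edge spider_pos (outer_edge j)"
  then obtain x where x: "x \<in> closed_segment (foot i) (tip i)" "p = proj_point x (tangent i x)"
    using assms by (auto simp: outer_edge_image)
  obtain y where y: "y \<in> closed_segment (foot j) (tip j)" "p = proj_point y (tangent j y)"
    using p assms by (auto simp: outer_edge_image)
  have "tangent i x > 0" "tangent j y > 0"
    using x y closed_segment_bound tangent_pos assms by blast+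
  then have "x = y" "tangent i x = tangent j x" using x y by (auto simp: proj_point_eq_iff)
  then have "x = m" using assms by (auto simp: tangent_eq_iff m_def)
  then show "p \<in> {proj_point m (tangent i m)}" using x by simp
qed

lemma foot_tangent_neq_mid:
  assumes "i < k" "j < k" "i \<noteq> j" "l < k" "l' < k"
  defines "m \<equiv> (real i + real j) / 2"
  shows "proj_point (foot l) (tangent l' (foot l)) \<noteq> proj_point m (tangent i m)"
proof -
  have "tangent i m > 0"
    using assms by (intro tangent_pos) (auto simp: m_def)
  then show ?thesis
    using tangent_foot_pos[of l' l] foot_neq_mid[of i j l] assms
    by (auto simp: proj_point_eq_iff m_def)
qed

text \<open>Inner edges meet only at the center, an inner edge misses all crossings of outer edges,
  and two tangents meet a third one at different midpoints.\<close>

lemma no_triple_crossing: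
  assumes "e \<in> edges (spider k 2)" "f \<in> edges (spider k 2)" "g \<in> edges (spider k 2)"
    and "e \<noteq> f" "e \<noteq> g" "f \<noteq> g"
  shows "edge_interior spider_pos (straight_edge spider_pos) e \<inter>
    edge_interior spider_pos (straight_edge spider_pos) f \<inter>
    edge_interior spider_pos (straight_edge spider_pos) g = {}" (is "?I e \<inter> ?I f \<inter> ?I g = {}")
proof -
  have II: "?I (inner_edge i) \<inter> ?I (inner_edge j) = {}" if "i < k" "j < k" "i \<noteq> j" for i j
    using inner_Int_inner[OF that] unfolding edge_interior_def
    by (auto simp: inner_edge_def spider_pos_simps)
  have IOO: "?I (inner_edge l) \<inter> ?I (outer_edge i) \<inter> ?I (outer_edge j) = {}"
    if "l < k" "i < k" "j < k" "i \<noteq> j" for l i j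
    using inner_Int_outer[of l i] outer_Int_outer[of i j] foot_tangent_neq_mid[of i j l i] that
    unfolding edge_interior_def by blast
  have OOO: "?I (outer_edge l) \<inter> ?I (outer_edge i) \<inter> ?I (outer_edge j) = {}"
    if "l < k" "i < k" "j < k" "l \<noteq> i" "l \<noteq> j" "i \<noteq> j" for l i j
  proof -
    let ?m = "(real l + real i) / 2" and ?m' = "(real l + real j) / 2"
    have "tangent l ?m > 0" "tangent l ?m' > 0"
      using that by (auto intro!: tangent_pos)
    then have "proj_point ?m (tangent l ?m) \<noteq> proj_point ?m' (tangent l ?m')"
      using that by (simp add: proj_point_eq_iff)
    then show ?thesis
      using outer_Int_outer[of l i] outer_Int_outer[of l j] that unfolding edge_interior_def by blast
  qed
  have "(\<exists>i<k. e = inner_edge i) \<or> (\<exists>i<k. e = outer_edge i)"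
    "(\<exists>i<k. f = inner_edge i) \<or> (\<exists>i<k. f = outer_edge i)"
    "(\<exists>i<k. g = inner_edge i) \<or> (\<exists>i<k. g = outer_edge i)"
    using assms(1-3) unfolding edges_spider2 by auto
  then show ?thesis
    using assms(4-6)
    \<comment> \<open>Of the eight combinations of edge types, four contain two inner edges, three
      contain exactly one, and one contains none.\<close>
    by (elim disjE exE conjE; hypsubst; simp only: inner_edge_eq_iff outer_edge_eq_iff simp_thms)
      (use II in blast, use II in blast, use II in blast, use IOO in blast,
       use II in blast, use IOO in blast, use IOO in blast, use OOO in blast)
qed

text \<open>Only the middle vertex of leg \<open>i\<close> has the abscissa \<open>foot i\<close>,
  and it is an end of the inner edge. A vertex of another leg on tangent \<open>i\<close> would have
  to sit at a midpoint \<open>(i + j) / 2\<close>, which feet and tips avoid.\<close>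

lemma vertex_not_in_interior:
  assumes "e \<in> edges (spider k 2)" "v \<in> verts (spider k 2)"
  shows "spider_pos v \<notin> edge_interior spider_pos (straight_edge spider_pos) e"
proof -
  have I: "spider_pos v \<notin> edge_interior spider_pos (straight_edge spider_pos) (inner_edge i)"
    if i: "i < k" for i
  proof
    assume "spider_pos v \<in> edge_interior spider_pos (straight_edge spider_pos) (inner_edge i)"
    then obtain h where h: "h > tangent i (foot i)" "spider_pos v = proj_point (foot i) h"
      unfolding inner_edge_interior[OF i] by auto
    then have "h > 0" using tangent_foot_pos[of i i] i by simp
    from assms(2) consider "v = Center" | j where "j < k" "v = Leg j 1" | j where "j < k" "v = Leg j 2"
      unfolding verts_spider2 by auto
    then show False
    proof cases
      case 1
      then show ?thesis using h proj_point_neq_0[OF \<open>h > 0\<close>, of "foot i"] by (simp add: spider_pos_simps)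
    next
      case 2
      then show ?thesis using h tangent_foot_pos[of j j] \<open>h > 0\<close> i
        by (auto simp: spider_pos_simps proj_point_eq_iff foot_eq_iff)
    next
      case 3
      then show ?thesis using h tangent_tip_pos[of j j] \<open>h > 0\<close> foot_neq_tip[of i j] i
        by (auto simp: spider_pos_simps proj_point_eq_iff)
    qed
  qed
  have O: "spider_pos v \<notin> edge_interior spider_pos (straight_edge spider_pos) (outer_edge i)"
    if i: "i < k" for i
  proof
    assume "spider_pos v \<in> edge_interior spider_pos (straight_edge spider_pos) (outer_edge i)"
    then obtain x where x: "x \<in> open_segment (foot i) (tip i)" "spider_pos v = proj_point x (tangent i x)"
      unfolding outer_edge_interior[OF i] by auto
    then have "tangent i x > 0" and ne: "x \<noteq> foot i" "x \<noteq> tip i"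
      using tangent_pos closed_segment_bound i by (auto simp: open_segment_def)
    from assms(2) consider "v = Center" | j where "j < k" "v = Leg j 1" | j where "j < k" "v = Leg j 2"
      unfolding verts_spider2 by auto
    then show False
    proof cases
      case 1
      then show ?thesis using x proj_point_neq_0[OF \<open>tangent i x > 0\<close>, of x] by (simp add: spider_pos_simps)
    next
      case 2
      then have "foot j = x" "tangent j x = tangent i x"
        using x tangent_foot_pos[of j j] \<open>tangent i x > 0\<close>
        by (auto simp: spider_pos_simps proj_point_eq_iff)
      then show ?thesis using 2 i ne foot_neq_mid[of j i j] by (auto simp: tangent_eq_iff)
    next
      case 3
      then have "tip j = x" "tangent j x = tangent i x"
        using x tangent_tip_pos[of j j] \<open>tangent i x > 0\<close>
        by (auto simp: spider_pos_simps proj_point_eq_iff)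
      then show ?thesis using 3 i ne tip_neq_mid[of j i j] by (auto simp: tangent_eq_iff)
    qed
  qed
  show ?thesis using assms(1) I O unfolding edges_spider2 by auto
qed

text \<open>Tips take only two abscissas, so their heights must separate them: two tangents do not
  meet at a tip by \<open>tip_neq_mid\<close>.\<close>

lemma inj_on_spider_pos: "inj_on spider_pos (verts (spider k 2))"
proof -
  have ff: "proj_point (foot i) (tangent i (foot i)) = proj_point (foot j) (tangent j (foot j)) \<longleftrightarrow> i = j"
    and ft: "proj_point (foot i) (tangent i (foot i)) \<noteq> proj_point (tip j) (tangent j (tip j))"
    and tt: "proj_point (tip i) (tangent i (tip i)) = proj_point (tip j) (tangent j (tip j)) \<longleftrightarrow> i = j"
    if "i < k" "j < k" for i j
    using that tangent_foot_pos[of i i] tangent_foot_pos[of j j] tangent_tip_pos[of i i]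
      tangent_tip_pos[of j j] foot_neq_tip[of i j] tip_neq_mid[of i j i]
    by (auto simp: proj_point_eq_iff foot_eq_iff tangent_eq_iff)
  have "proj_point (foot i) (tangent i (foot i)) \<noteq> 0" "proj_point (tip i) (tangent i (tip i)) \<noteq> 0"
    if "i < k" for i
    using that tangent_foot_pos tangent_tip_pos proj_point_neq_0 by blast+
  note nz = this this[THEN not_sym]
  show ?thesis
    unfolding verts_spider2 inj_on_def
    by (auto simp: spider_pos_simps ff tt nz ft ft[THEN not_sym])
qed

lemma rectilinear_drawing_spider_pos: "rectilinear_drawing (spider k 2) spider_pos"
  unfolding rectilinear_drawing_def good_drawing_def
proof (intro conjI ballI impI inj_on_spider_pos)
  fix e assume e: "e \<in> edges (spider k 2)"
  have "\<exists>u v. e = {u, v} \<and> u \<in> verts (spider k 2) \<and> v \<in> verts (spider k 2) \<and> u \<noteq> v"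
    using e unfolding edges_spider2 verts_spider2 inner_edge_def outer_edge_def by fastforce
  then obtain u v where uv: "e = {u, v}" "u \<in> verts (spider k 2)" "v \<in> verts (spider k 2)" "u \<noteq> v"
    by blast
  then have "spider_pos u \<noteq> spider_pos v" using inj_on_spider_pos by (auto dest: inj_onD)
  then show "\<exists>g. arc g \<and> path_image g = straight_edge spider_pos e \<and>
      {pathstart g, pathfinish g} = spider_pos ` e"
    using uv(1) by (intro exI[of _ "linepath (spider_pos u) (spider_pos v)"])
      (simp add: straight_edge_def segment_convex_hull arc_linepath)
next
  fix e f assume ef: "e \<in> edges (spider k 2)" "f \<in> edges (spider k 2)" "e \<noteq> f"
  then have "(\<exists>i<k. e = inner_edge i) \<or> (\<exists>i<k. e = outer_edge i)"
    "(\<exists>i<k. f = inner_edge i) \<or> (\<exists>i<k. f = outer_edge i)"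
    unfolding edges_spider2 by auto
  then show "\<exists>p. straight_edge spider_pos e \<inter> straight_edge spider_pos f \<subseteq> {p}"
    using ef(3) inner_Int_inner inner_Int_outer outer_Int_outer
    by (elim disjE exE conjE) (metis Int_commute)+
next
  fix e f g
  assume "e \<in> edges (spider k 2)" "f \<in> edges (spider k 2)" "g \<in> edges (spider k 2)"
    and "e \<noteq> f \<and> e \<noteq> g \<and> f \<noteq> g"
  then show "edge_interior spider_pos (straight_edge spider_pos) e \<inter>
    edge_interior spider_pos (straight_edge spider_pos) f \<inter>
    edge_interior spider_pos (straight_edge spider_pos) g = {}"
    using no_triple_crossing by blast
qed (use vertex_not_in_interior in blast)

section \<open>Crossings in this drawing\<close>

lemma outer_crosses_outer:
  assumes "i < j" "j < k"
  shows "crosses spider_pos (outer_edge i) (outer_edge j)"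
proof -
  define m where "m = (real i + real j) / 2"
  have m: "0 < m" "m < real k" using assms by (auto simp: m_def)
  \<comment> \<open>Foot and tip of every leg lie on different sides of the open strip between 0 and
    \<open>k\<close>, so each outer edge spans the strip.\<close>
  have "m \<in> open_segment (foot l) (tip l)" if "l < k" for l
    using m that by (auto simp: open_segment_eq_real_ivl foot_def tip_def)
  then have in_interior: "proj_point m (tangent l m) \<in>
      edge_interior spider_pos (straight_edge spider_pos) (outer_edge l)" if "l < k" for l
    using that by (simp add: outer_edge_interior)
  have "tangent i m = tangent j m" by (simp add: tangent_eq_iff m_def)
  then have "proj_point m (tangent i m) \<in>
      edge_interior spider_pos (straight_edge spider_pos) (outer_edge i) \<inter>
      edge_interior spider_pos (straight_edge spider_pos) (outer_edge j)"
    using in_interior[of i] in_interior[of j] assms by simp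
  then show ?thesis unfolding crosses_def by blast
qed

text \<open>Before projection, the inner edge is the upward ray from its middle vertex, so an outer
  edge passing above that vertex crosses it.\<close>

lemma inner_crosses_outerI:
  assumes "i < k" "j < k" "foot i \<in> open_segment (foot j) (tip j)"
    and "tangent i (foot i) < tangent j (foot i)"
  shows "crosses spider_pos (inner_edge i) (outer_edge j)"
proof -
  have "proj_point (foot i) (tangent j (foot i)) \<in>
      edge_interior spider_pos (straight_edge spider_pos) (inner_edge i) \<inter>
      edge_interior spider_pos (straight_edge spider_pos) (outer_edge j)"
    using assms by (auto simp: inner_edge_interior outer_edge_interior)
  then show ?thesis unfolding crosses_def by blast
qed

text \<open>Here \<open>foot i\<close> is on the right, where the larger index gives the higher
  tangent. Outer edge \<open>j\<close> passes over it, starting farther right if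
  \<open>j < r\<close> and coming from the left otherwise.\<close>

lemma lower_inner_crosses_upper_outer:
  assumes "i < j" "j < k" "i < r"
  shows "crosses spider_pos (inner_edge i) (outer_edge j)"
  using assms
  by (intro inner_crosses_outerI)
    (auto simp: tangent_less_iff foot_def tip_def open_segment_eq_real_ivl)

text \<open>Here \<open>foot j\<close> is on the left, where the smaller index gives the higher
  tangent. Outer edge \<open>i\<close> starts farther left if \<open>r \<le> i\<close> and comes
  from the right otherwise.\<close>

lemma upper_inner_crosses_lower_outer:
  assumes "i < j" "j < k" "r \<le> j"
  shows "crosses spider_pos (inner_edge j) (outer_edge i)"
  using assms
  by (intro inner_crosses_outerI)
    (auto simp: tangent_less_iff foot_def tip_def open_segment_eq_real_ivl)

text \<open>Every pair of legs has its outer crossing and at least one inner-outer crossing; the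
  \<open>r * (k - r)\<close> pairs with feet on different sides have both of the latter.\<close>

lemma crossings_spider_pos: "2 * (k choose 2) + r * (k - r) \<le> crossings (spider k 2) spider_pos"
proof -
  define U where "U = {(i, j) \<in> index_pairs k. crosses spider_pos (inner_edge i) (outer_edge j)}"
  define V where "V = {(i, j) \<in> index_pairs k. crosses spider_pos (inner_edge j) (outer_edge i)}"
  define W where "W = {(i, j) \<in> index_pairs k. crosses spider_pos (outer_edge i) (outer_edge j)}"
  have "W = index_pairs k"
    using outer_crosses_outer by (auto simp: W_def index_pairs_def)
  moreover have "U \<union> V = index_pairs k"
  proof
    show "index_pairs k \<subseteq> U \<union> V"
    proof
      fix x assume "x \<in> index_pairs k"
      then obtain i j where x: "x = (i, j)" "i < j" "j < k" by (auto simp: index_pairs_def)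
      show "x \<in> U \<union> V"
      proof (cases "i < r")
        case True
        then show ?thesis
          using lower_inner_crosses_upper_outer[of i j] x by (simp add: U_def index_pairs_def)
      next
        case False
        then show ?thesis
          using upper_inner_crosses_lower_outer[of i j] x by (simp add: V_def index_pairs_def)
      qed
    qed
  qed (auto simp: U_def V_def)
  moreover have "{..<r} \<times> {r..<k} \<subseteq> U \<inter> V"
    using lower_inner_crosses_upper_outer upper_inner_crosses_lower_outer
    by (auto simp: U_def V_def index_pairs_def)
  then have "card ({..<r} \<times> {r..<k}) \<le> card (U \<inter> V)"
    by (rule card_mono[rotated]) (rule finite_subset[OF _ finite_index_pairs[of k]], auto simp: U_def)
  moreover have "crossings (spider k 2) spider_pos = card W + (card (U \<union> V) + card (U \<inter> V))"
    using crossings_spider2[OF rectilinear_drawing_spider_pos] unfolding U_def V_def W_def by blast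
  ultimately show ?thesis by (simp add: card_index_pairs card_cartesian_product)
qed

end

section \<open>The value of the maximum\<close>

lemma half_mult_half: "(k div 2) * (k - k div 2) = k * k div (4::nat)"
proof (cases "even k")
  case True
  then show ?thesis by (auto elim!: evenE)
next
  case False
  then obtain a where k: "k = 2 * a + 1" by (auto elim!: oddE)
  have "k * k = 4 * (a * (a + 1)) + 1" by (simp add: k algebra_simps)
  then have "k * k div 4 = a * (a + 1)" by linarith
  then show ?thesis by (simp add: k)
qed

theorem theorem2:
  fixes k :: nat
  assumes "k \<ge> 3"
  shows "int (max_rectilinear_crossing_number (spider k 2)) =
    int ((2 * k) choose 2) - 2 * int (k choose 2) - int k + \<lfloor>(real k)\<^sup>2 / 4\<rfloor>"
proof -
  let ?N = "2 * (k choose 2) + k * k div 4"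
  let ?S = "{crossings (spider k 2) pos | pos. rectilinear_drawing (spider k 2) pos}"
  \<comment> \<open>The balanced choice \<open>r = k div 2\<close> makes \<open>r * (k - r)\<close>
    equal to \<open>k * k div 4\<close>.\<close>
  obtain pos where pos: "rectilinear_drawing (spider k 2) pos" "?N \<le> crossings (spider k 2) pos"
    using rectilinear_drawing_spider_pos[of "k div 2" k] crossings_spider_pos[of "k div 2" k] assms
    unfolding half_mult_half by auto
  have le: "\<And>n. n \<in> ?S \<Longrightarrow> n \<le> ?N" using crossings_spider2_le by blast
  have "crossings (spider k 2) pos = ?N"
    using pos crossings_spider2_le by (meson le_antisym)
  then have "?N \<in> ?S" using pos(1) by (metis (mono_tags, lifting) mem_Collect_eq)
  then have "max_rectilinear_crossing_number (spider k 2) = ?N"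
    unfolding max_rectilinear_crossing_number_def
    using le by (intro Max_eqI) (auto intro: finite_subset[of _ "{..?N}"])
  moreover have "\<lfloor>(real k)\<^sup>2 / 4\<rfloor> = int (k * k div 4)"
    using floor_divide_of_nat_eq[of "k * k" 4] by (simp add: power2_eq_square)
  \<comment> \<open>This identity reduces the stated formula to \<open>2 * (k choose 2)\<close> plus
    the floor term.\<close>
  moreover have "int ((2 * k) choose 2) = 4 * int (k choose 2) + int k"
  proof -
    have "2 * (n choose 2) = n * (n - 1)" for n :: nat
      by (cases n) (simp_all add: choose_two)
    from this[of k] this[of "2 * k"] have "(2 * k) choose 2 = 4 * (k choose 2) + k"
      using assms by (cases k) (auto simp: algebra_simps)
    then show ?thesis by simp
  qed
  ultimately show ?thesis by simp
qed

end
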